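(* Let $\alpha\in\mathbb{R}$. For every $n\ge1$, $$Z\hat C(\Delta_T^{n+1};B_\alpha)=\hat B(\Delta_T^{n+1};B_\alpha).$$
   Context: Fix $T>0$. $(B_\alpha)_{\alpha\in\mathbb{R}}$ is a Banach scale, i.e. a family of Banach spaces such that for $\alpha\le\beta$ the embedding $B_\beta\hookrightarrow B_\alpha$ is continuous. $S=(S_t)_{t\ge0}$ is an analytic (in particular strongly continuous) semigroup of bounded linear operators acting on this scale, with $S_0=\mathrm{Id}$; for every $\alpha\in\mathbb{R}$, $\varepsilon\in(0,1)$ there is $C_{\alpha,\varepsilon,T}>0$ with $\|S_tx\|_{B_{\alpha+\varepsilon}}\le C_{\alpha,\varepsilon,T}t^{-\varepsilon}\|x\|_{B_\alpha}$ and $\|(S_t-\mathrm{Id})x\|_{B_\alpha}\le C_{\alpha,\varepsilon,T}t^{\varepsilon}\|x\|_{B_{\alpha+\varepsilon}}$ for all $t\in(0,T]$. For $n\ge1$, $\Delta_T^n:=\{(t_1,\dots,t_n)\in[0,T]^n: 0\le t_n\le\dots\le t_1\le T\}$, and $C(\Delta_T^n;B_\alpha)$ is the space of continuous maps $\Delta_T^n\to B_\alpha$. The coboundary $\delta:C(\Delta_T^n;B_\alpha)\to C(\Delta_T^{n+1};B_\alpha)$ is $(\delta g)_{t_1\dots t_{n+1}}:=\sum_{i=1}^{n+1}(-1)^i g_{t_1\dots\hat t_i\dots t_{n+1}}$ ($\hat t_i$ means the argument is omitted). With $a_{ts}:=S_{t-s}-\mathrm{Id}$ for $0\le s\le t\le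 T$, set $(ag)_{t_1\dots t_{n+1}}:=a_{t_1t_2}g_{t_2\dots t_{n+1}}$ and $\hat\delta:=\delta-a$. Here $Z\hat C(\Delta_T^{n+1};B_\alpha):=\ker(\hat\delta)\cap C(\Delta_T^{n+1};B_\alpha)$, and $\hat B(\Delta_T^{n+1};B_\alpha):=\operatorname{Im}(\hat\delta)\cap C(\Delta_T^{n+1};B_\alpha)$ is the image of $\hat\delta:C(\Delta_T^{n};B_\alpha)\to C(\Delta_T^{n+1};B_\alpha)$. *)

theory Defs
  imports "HOL-Analysis.Analysis"
begin

text \<open>
  A Banach space is given by a linear subspace \<open>V\<close> of an ambient real vector space and a norm
  \<open>N\<close> that is only constrained on \<open>V\<close>.  The distance is truncated outside \<open>V\<close> because
  the locale \<open>Metric_space\<close> asks for nonnegativity and symmetry on the whole type.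
\<close>

definition norm_dist :: "'a::real_vector set \<Rightarrow> ('a \<Rightarrow> real) \<Rightarrow> 'a \<Rightarrow> 'a \<Rightarrow> real" where
  "norm_dist V N x y = (if x \<in> V \<and> y \<in> V then N (x - y) else 0)"

definition norm_topology :: "'a::real_vector set \<Rightarrow> ('a \<Rightarrow> real) \<Rightarrow> 'a topology" where
  "norm_topology V N = Metric_space.mtopology V (norm_dist V N)"

definition banach_space_on :: "'a::real_vector set \<Rightarrow> ('a \<Rightarrow> real) \<Rightarrow> bool" where
  "banach_space_on V N \<longleftrightarrow>
     subspace V \<and>
     (\<forall>x\<in>V. N x \<ge> 0) \<and>
     (\<forall>x\<in>V. N x = 0 \<longleftrightarrow> x = 0) \<and>
     (\<forall>c. \<forall>x\<in>V. N (c *\<^sub>R x) = \<bar>c\<bar> * N x) \<and>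
     (\<forall>x\<in>V. \<forall>y\<in>V. N (x + y) \<le> N x + N y) \<and>
     Metric_space.mcomplete V (norm_dist V N)"

definition bounded_operator_on ::
  "'a::real_vector set \<Rightarrow> ('a \<Rightarrow> real) \<Rightarrow> ('a \<Rightarrow> 'a) \<Rightarrow> bool" where
  "bounded_operator_on V N f \<longleftrightarrow>
     (\<forall>x\<in>V. f x \<in> V) \<and>
     (\<forall>x\<in>V. \<forall>y\<in>V. f (x + y) = f x + f y) \<and>
     (\<forall>c. \<forall>x\<in>V. f (c *\<^sub>R x) = c *\<^sub>R f x) \<and>
     (\<exists>C. \<forall>x\<in>V. N (f x) \<le> C * N x)"

text \<open>
  The spaces \<open>B \<alpha>\<close> live in one ambient vector space, which can be taken to be their inductive
  limit as \<open>\<alpha>\<close> tends to minus infinity, so that the embeddings are inclusions.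
\<close>

definition banach_scale :: "(real \<Rightarrow> 'a::real_vector set) \<Rightarrow> (real \<Rightarrow> 'a \<Rightarrow> real) \<Rightarrow> bool" where
  "banach_scale B N \<longleftrightarrow>
     (\<forall>\<alpha>. banach_space_on (B \<alpha>) (N \<alpha>)) \<and>
     (\<forall>\<alpha> \<beta>. \<alpha> \<le> \<beta> \<longrightarrow> B \<beta> \<subseteq> B \<alpha> \<and> (\<exists>C. \<forall>x\<in>B \<beta>. N \<alpha> x \<le> C * N \<beta> x))"

definition C0_semigroup_on ::
  "'a::real_vector set \<Rightarrow> ('a \<Rightarrow> real) \<Rightarrow> (real \<Rightarrow> 'a \<Rightarrow> 'a) \<Rightarrow> bool" where
  "C0_semigroup_on V N S \<longleftrightarrow>
     (\<forall>t\<ge>0. bounded_operator_on V N (S t)) \<and>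
     (\<forall>x\<in>V. S 0 x = x) \<and>
     (\<forall>s\<ge>0. \<forall>t\<ge>0. \<forall>x\<in>V. S (s + t) x = S s (S t x)) \<and>
     (\<forall>x\<in>V. continuous_map (top_of_set {0..}) (norm_topology V N) (\<lambda>t. S t x))"

text \<open>
  Analyticity refers to the complexification \<open>V \<times> V\<close>, a pair \<open>(x, y)\<close> standing for
  \<open>x + \<i> y\<close>.  Only the equivalence class of the norm on it matters below.  Complex Banach spaces
  are covered by forgetting the complex structure: the complexification of such a space is the sum
  of the space and its conjugate, and the sectors used are symmetric under conjugation.
\<close>

definition cscale :: "complex \<Rightarrow> 'a \<times> 'a \<Rightarrow> 'a::real_vector \<times> 'a" where
  "cscale c p = (Re c *\<^sub>R fst p - Im c *\<^sub>R snd p, Re c *\<^sub>R snd p + Im c *\<^sub>R fst p)"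

definition cnorm :: "('a \<Rightarrow> real) \<Rightarrow> 'a \<times> 'a \<Rightarrow> real" where
  "cnorm N p = N (fst p) + N (snd p)"

definition bounded_coperator_on ::
  "'a::real_vector set \<Rightarrow> ('a \<Rightarrow> real) \<Rightarrow> ('a \<times> 'a \<Rightarrow> 'a \<times> 'a) \<Rightarrow> bool" where
  "bounded_coperator_on V N F \<longleftrightarrow>
     bounded_operator_on (V \<times> V) (cnorm N) F \<and>
     (\<forall>c. \<forall>p\<in>V \<times> V. F (cscale c p) = cscale c (F p))"

definition sector :: "real \<Rightarrow> complex set" where
  "sector \<theta> = {z. z \<noteq> 0 \<and> \<bar>Arg z\<bar> < \<theta>}"

text \<open>
  An analytic semigroup is one that extends to a semigroup on a sector which is holomorphic for the
  operator norm and strongly continuous at the vertex.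
\<close>

definition analytic_semigroup_on ::
  "'a::real_vector set \<Rightarrow> ('a \<Rightarrow> real) \<Rightarrow> (real \<Rightarrow> 'a \<Rightarrow> 'a) \<Rightarrow> bool" where
  "analytic_semigroup_on V N S \<longleftrightarrow>
     C0_semigroup_on V N S \<and>
     (\<exists>\<theta> Z. 0 < \<theta> \<and> \<theta> \<le> pi / 2 \<and>
        (\<forall>t\<ge>0. \<forall>x\<in>V. Z (complex_of_real t) (x, 0) = (S t x, 0)) \<and>
        (\<forall>z\<in>insert 0 (sector \<theta>). bounded_coperator_on V N (Z z)) \<and>
        (\<forall>z\<in>insert 0 (sector \<theta>). \<forall>w\<in>insert 0 (sector \<theta>). \<forall>p\<in>V \<times> V.
            Z (z + w) p = Z z (Z w p)) \<and>
        (\<forall>z\<in>sector \<theta>. \<exists>D. bounded_coperator_on V N D \<and>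
            (\<forall>e>0. \<forall>\<^sub>F w in at z. \<forall>p\<in>V \<times> V.
               cnorm N (Z w p - Z z p - cscale (w - z) (D p)) \<le> e * cmod (w - z) * cnorm N p)) \<and>
        (\<forall>p\<in>V \<times> V. ((\<lambda>z. cnorm N (Z z p - p)) \<longlongrightarrow> 0) (at 0 within sector \<theta>)))"

definition analytic_semigroup_on_scale ::
  "real \<Rightarrow> (real \<Rightarrow> 'a::real_vector set) \<Rightarrow> (real \<Rightarrow> 'a \<Rightarrow> real) \<Rightarrow> (real \<Rightarrow> 'a \<Rightarrow> 'a) \<Rightarrow> bool" where
  "analytic_semigroup_on_scale T B N S \<longleftrightarrow>
     (\<forall>\<alpha>. analytic_semigroup_on (B \<alpha>) (N \<alpha>) S) \<and>
     (\<forall>\<alpha> \<epsilon>. 0 < \<epsilon> \<and> \<epsilon> < 1 \<longrightarrow>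
        (\<exists>C>0. \<forall>t. 0 < t \<and> t \<le> T \<longrightarrow>
           (\<forall>x\<in>B \<alpha>. S t x \<in> B (\<alpha> + \<epsilon>) \<and> N (\<alpha> + \<epsilon>) (S t x) \<le> C * t powr (- \<epsilon>) * N \<alpha> x) \<and>
           (\<forall>x\<in>B (\<alpha> + \<epsilon>). N \<alpha> (S t x - x) \<le> C * t powr \<epsilon> * N (\<alpha> + \<epsilon>) x)))"

text \<open>
  A tuple \<open>(t\<^sub>1, \<dots>, t\<^sub>n)\<close> is an extensional function on \<open>{1..n}\<close>, and a map on the simplex is
  extensional on it, so that equality of maps is equality on the simplex.
\<close>

definition simplex_dom :: "real \<Rightarrow> nat \<Rightarrow> (nat \<Rightarrow> real) set" where
  "simplex_dom T n =
     {t \<in> {1..n} \<rightarrow>\<^sub>E {0..T}. \<forall>i\<in>{1..n}. \<forall>j\<in>{1..n}. i \<le> j \<longrightarrow> t j \<le> t i}"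

definition cochains ::
  "real \<Rightarrow> nat \<Rightarrow> 'a::real_vector set \<Rightarrow> ('a \<Rightarrow> real) \<Rightarrow> ((nat \<Rightarrow> real) \<Rightarrow> 'a) set" where
  "cochains T n V N =
     {g \<in> extensional (simplex_dom T n).
        continuous_map
          (subtopology (product_topology (\<lambda>_. euclideanreal) {1..n}) (simplex_dom T n))
          (norm_topology V N) g}"

definition omit_arg :: "nat \<Rightarrow> nat \<Rightarrow> (nat \<Rightarrow> real) \<Rightarrow> nat \<Rightarrow> real" where
  "omit_arg n i t = (\<lambda>j\<in>{1..n}. if j < i then t j else t (j + 1))"

definition coboundary ::
  "real \<Rightarrow> nat \<Rightarrow> ((nat \<Rightarrow> real) \<Rightarrow> 'a::real_vector) \<Rightarrow> (nat \<Rightarrow> real) \<Rightarrow> 'a" where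
  "coboundary T n g =
     (\<lambda>t\<in>simplex_dom T (n + 1). \<Sum>i = 1..n + 1. ((- 1) ^ i) *\<^sub>R g (omit_arg n i t))"

definition semigroup_incr ::
  "(real \<Rightarrow> 'a \<Rightarrow> 'a) \<Rightarrow> real \<Rightarrow> real \<Rightarrow> 'a \<Rightarrow> 'a::real_vector" where
  "semigroup_incr S t s x = S (t - s) x - x"

definition incr_map ::
  "real \<Rightarrow> (real \<Rightarrow> 'a \<Rightarrow> 'a) \<Rightarrow> nat \<Rightarrow>
     ((nat \<Rightarrow> real) \<Rightarrow> 'a::real_vector) \<Rightarrow> (nat \<Rightarrow> real) \<Rightarrow> 'a" where
  "incr_map T S n g =
     (\<lambda>t\<in>simplex_dom T (n + 1). semigroup_incr S (t 1) (t 2) (g (omit_arg n 1 t)))"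

definition hat_coboundary ::
  "real \<Rightarrow> (real \<Rightarrow> 'a \<Rightarrow> 'a) \<Rightarrow> nat \<Rightarrow>
     ((nat \<Rightarrow> real) \<Rightarrow> 'a::real_vector) \<Rightarrow> (nat \<Rightarrow> real) \<Rightarrow> 'a" where
  "hat_coboundary T S n g =
     (\<lambda>t\<in>simplex_dom T (n + 1). coboundary T n g t - incr_map T S n g t)"

definition hat_cocycles ::
  "real \<Rightarrow> (real \<Rightarrow> 'a \<Rightarrow> 'a) \<Rightarrow> nat \<Rightarrow> 'a::real_vector set \<Rightarrow> ('a \<Rightarrow> real) \<Rightarrow>
     ((nat \<Rightarrow> real) \<Rightarrow> 'a) set" where
  "hat_cocycles T S n V N =
     {g \<in> cochains T n V N. hat_coboundary T S n g = (\<lambda>t\<in>simplex_dom T (n + 1). 0)}"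

text \<open>Indexed by the number of arguments of the coboundaries; meant for \<open>n \<ge> 2\<close>.\<close>

definition hat_coboundaries ::
  "real \<Rightarrow> (real \<Rightarrow> 'a \<Rightarrow> 'a) \<Rightarrow> nat \<Rightarrow> 'a::real_vector set \<Rightarrow> ('a \<Rightarrow> real) \<Rightarrow>
     ((nat \<Rightarrow> real) \<Rightarrow> 'a) set" where
  "hat_coboundaries T S n V N =
     hat_coboundary T S (n - 1) ` cochains T (n - 1) V N \<inter> cochains T n V N"

end

theory Submission imports Defs begin

text \<open>
  The operator \<open>\<delta> - a\<close> is an alternating sum of faces: the first face drops \<open>t\<^sub>1\<close> and applies
  \<open>S\<close> at time \<open>t\<^sub>1 - t\<^sub>2\<close>, every other face only drops its argument, because subtracting \<open>a\<close>
  trades the identity in the first term of \<open>\<delta>\<close> for the semigroup.  These faces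
  satisfy the simplicial identities; the only one that is not plain combinatorics is
  \<open>S (t\<^sub>1 - t\<^sub>2) (S (t\<^sub>2 - t\<^sub>3) x) = S (t\<^sub>1 - t\<^sub>3) x\<close>, which is the semigroup law.  Hence the operator
  squares to zero (\<open>hat_coboundary_hat_coboundary\<close>), and coboundaries are cocycles.

  Conversely the simplex can be coned off at time \<open>0\<close>, the smallest possible last argument:
  \<open>h \<mapsto> h (\<dots>, 0)\<close> is a contracting homotopy up to sign.  The last face of \<open>(t\<^sub>1, \<dots>, t\<^sub>n\<^sub>+\<^sub>1, 0)\<close>
  is \<open>t\<close> itself, and the other faces keep the final \<open>0\<close> and assemble to the coboundary of
  \<open>h (\<dots>, 0)\<close> (\<open>hat_coboundary_append_zero\<close>).  So a cocycle \<open>h\<close> is, up to sign, the coboundary of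
  \<open>h (\<dots>, 0)\<close>, which inherits continuity from \<open>h\<close>.  Appending at the end rather than in
  front is what keeps the homotopy away from the semigroup, which acts on the first argument.
\<close>

section \<open>The simplices\<close>

lemma simplex_dom_antimono:
  assumes "t \<in> simplex_dom T n" "1 \<le> i" "i \<le> j" "j \<le> n"
  shows "t j \<le> t i"
  using assms by (auto simp: simplex_dom_def)

lemma omit_arg_in_simplex_dom:
  assumes "t \<in> simplex_dom T (n + 1)"
  shows "omit_arg n i t \<in> simplex_dom T n"
  using assms by (auto simp: simplex_dom_def omit_arg_def PiE_def Pi_def)

lemma omit_arg_omit_arg:
  assumes "1 \<le> i" "i \<le> j"
  shows "omit_arg n j (omit_arg (n + 1) i t) = omit_arg n i (omit_arg (n + 1) (j + 1) t)"
  using assms by (auto simp: omit_arg_def fun_eq_iff)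

definition append_zero :: "nat \<Rightarrow> (nat \<Rightarrow> real) \<Rightarrow> nat \<Rightarrow> real" where
  "append_zero n t = (\<lambda>j\<in>{1..n + 1}. if j \<le> n then t j else 0)"

lemma append_zero_in_simplex_dom:
  assumes "T > 0" "t \<in> simplex_dom T n"
  shows "append_zero n t \<in> simplex_dom T (n + 1)"
  using assms by (auto simp: simplex_dom_def append_zero_def PiE_def Pi_def)

lemma omit_arg_append_zero:
  assumes "i \<le> n + 1"
  shows "omit_arg (n + 1) i (append_zero (n + 1) t) = append_zero n (omit_arg n i t)"
  using assms by (auto simp: omit_arg_def append_zero_def fun_eq_iff)

lemma omit_last_append_zero:
  assumes "t \<in> simplex_dom T n"
  shows "omit_arg n (n + 1) (append_zero n t) = t"
  using assms
  by (auto simp: omit_arg_def append_zero_def fun_eq_iff simplex_dom_def PiE_def extensional_def)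

section \<open>The twisted faces\<close>

definition twisted_face ::
  "(real \<Rightarrow> 'a \<Rightarrow> 'a) \<Rightarrow> nat \<Rightarrow> nat \<Rightarrow> ((nat \<Rightarrow> real) \<Rightarrow> 'a) \<Rightarrow> (nat \<Rightarrow> real) \<Rightarrow> 'a" where
  "twisted_face S n i g t =
     (if i = 1 then S (t 1 - t 2) (g (omit_arg n 1 t)) else g (omit_arg n i t))"

text \<open>The identity in \<open>a\<close> cancels the first term of \<open>\<delta>\<close>, whose sign is \<open>-1\<close>.\<close>

lemma hat_coboundary_eq_sum_twisted_face:
  assumes "t \<in> simplex_dom T (n + 1)"
  shows "hat_coboundary T S n g t = (\<Sum>i = 1..n + 1. (- 1) ^ i *\<^sub>R twisted_face S n i g t)"
proof -
  have "(\<Sum>i = 1..n + 1. (- 1) ^ i *\<^sub>R g (omit_arg n i t)) =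
      - g (omit_arg n 1 t) + (\<Sum>i = Suc 1..n + 1. (- 1) ^ i *\<^sub>R g (omit_arg n i t))"
    by (subst sum.atLeast_Suc_atMost) simp_all
  moreover have "(\<Sum>i = 1..n + 1. (- 1) ^ i *\<^sub>R twisted_face S n i g t) =
      - S (t 1 - t 2) (g (omit_arg n 1 t)) +
      (\<Sum>i = Suc 1..n + 1. (- 1) ^ i *\<^sub>R g (omit_arg n i t))"
    by (subst sum.atLeast_Suc_atMost) (simp_all add: twisted_face_def)
  ultimately show ?thesis
    using assms
    by (simp add: hat_coboundary_def coboundary_def incr_map_def semigroup_incr_def)
qed

lemma C0_semigroup_on_sum:
  assumes "C0_semigroup_on V N S" "subspace V" "s \<ge> 0" "\<And>i. i \<in> A \<Longrightarrow> x i \<in> V"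
  shows "S s (\<Sum>i\<in>A. c i *\<^sub>R x i) = (\<Sum>i\<in>A. c i *\<^sub>R S s (x i))"
proof -
  have add: "S s (u + v) = S s u + S s v" if "u \<in> V" "v \<in> V" for u v
    using assms(1,3) that by (auto simp: C0_semigroup_on_def bounded_operator_on_def)
  have scale: "S s (r *\<^sub>R u) = r *\<^sub>R S s u" if "u \<in> V" for r u
    using assms(1,3) that by (auto simp: C0_semigroup_on_def bounded_operator_on_def)
  have zero: "S s 0 = 0"
    using scale[of 0 0] subspace_0[OF assms(2)] by simp
  show ?thesis
    using assms(4)
  proof (induction A rule: infinite_finite_induct)
    case (insert i A)
    then have "(\<Sum>i\<in>A. c i *\<^sub>R x i) \<in> V" "c i *\<^sub>R x i \<in> V" "x i \<in> V"
      by (auto intro!: subspace_sum subspace_scale assms(2))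
    with insert show ?case
      by (simp add: add scale)
  qed (simp_all add: zero)
qed

lemma twisted_face_sum:
  assumes "C0_semigroup_on V N S" "subspace V"
    and "t \<in> simplex_dom T (n + 1)" "n \<ge> 1"
    and "\<And>j u. j \<in> A \<Longrightarrow> u \<in> simplex_dom T n \<Longrightarrow> f j u \<in> V"
    and "\<And>u. u \<in> simplex_dom T n \<Longrightarrow> g u = (\<Sum>j\<in>A. c j *\<^sub>R f j u)"
  shows "twisted_face S n i g t = (\<Sum>j\<in>A. c j *\<^sub>R twisted_face S n i (f j) t)"
proof -
  have nonneg: "t 1 - t 2 \<ge> 0"
    using simplex_dom_antimono[OF assms(3), of 1 2] assms(4) by simp
  have om: "omit_arg n k t \<in> simplex_dom T n" for k
    using omit_arg_in_simplex_dom[OF assms(3)] .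
  have "S (t 1 - t 2) (\<Sum>j\<in>A. c j *\<^sub>R f j (omit_arg n 1 t)) =
      (\<Sum>j\<in>A. c j *\<^sub>R S (t 1 - t 2) (f j (omit_arg n 1 t)))"
    using assms(5)[OF _ om] by (intro C0_semigroup_on_sum[OF assms(1,2) nonneg])
  then show ?thesis
    unfolding twisted_face_def by (cases "i = 1") (simp_all add: assms(6)[OF om])
qed

lemma twisted_face_in:
  assumes "C0_semigroup_on V N S"
    and "t \<in> simplex_dom T (n + 1)" "n \<ge> 1"
    and "\<And>u. u \<in> simplex_dom T n \<Longrightarrow> g u \<in> V"
  shows "twisted_face S n i g t \<in> V"
proof -
  have "t 1 - t 2 \<ge> 0"
    using simplex_dom_antimono[OF assms(2), of 1 2] assms(3) by simp
  then show ?thesis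
    using assms(1) assms(4)[OF omit_arg_in_simplex_dom[OF assms(2)]]
    by (auto simp: twisted_face_def C0_semigroup_on_def bounded_operator_on_def)
qed

text \<open>
  Only the case \<open>i = j = 1\<close> involves two applications of \<open>S\<close> on one side and a single one on the
  other; it is the semigroup law.
\<close>

lemma twisted_face_twisted_face:
  assumes "C0_semigroup_on V N S"
    and "t \<in> simplex_dom T (n + 2)" "n \<ge> 1"
    and "\<And>u. u \<in> simplex_dom T n \<Longrightarrow> g u \<in> V"
    and "1 \<le> i" "i \<le> j"
  shows "twisted_face S (n + 1) i (twisted_face S n j g) t =
    twisted_face S (n + 1) (j + 1) (twisted_face S n i g) t"
proof -
  have omit: "omit_arg n j (omit_arg (n + 1) i t) = omit_arg n i (omit_arg (n + 1) (j + 1) t)"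
    by (rule omit_arg_omit_arg[OF assms(5,6)])
  have args: "omit_arg (n + 1) k t 1 = (if k \<le> 1 then t 2 else t 1)"
      "omit_arg (n + 1) k t 2 = (if k \<le> 2 then t 3 else t 2)" for k
    using assms(3) by (auto simp: omit_arg_def numeral_eq_Suc)
  consider "i = 1" "j = 1" | "i = 1" "j > 1" | "i > 1"
    using assms(5,6) by linarith
  then show ?thesis
  proof cases
    case 1
    define x where "x = g (omit_arg n 1 (omit_arg (n + 1) 1 t))"
    have "x \<in> V"
      unfolding x_def using assms(2) by (intro assms(4) omit_arg_in_simplex_dom) simp
    moreover have "t 2 \<le> t 1" "t 3 \<le> t 2"
      using simplex_dom_antimono[OF assms(2), of 1 2] simplex_dom_antimono[OF assms(2), of 2 3]
        assms(3) by simp_all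
    ultimately have "S ((t 1 - t 2) + (t 2 - t 3)) x = S (t 1 - t 2) (S (t 2 - t 3) x)"
      using assms(1) unfolding C0_semigroup_on_def by (meson diff_ge_0_iff_ge)
    then show ?thesis
      using 1 omit by (simp add: twisted_face_def args x_def del: One_nat_def)
  next
    case 2
    then show ?thesis
      using omit by (simp add: twisted_face_def args del: One_nat_def)
  next
    case 3
    then show ?thesis
      using omit assms(6) by (simp add: twisted_face_def)
  qed
qed

section \<open>Coboundaries are cocycles\<close>

text \<open>
  The involution \<open>(i, j) \<leftrightarrow> (j + 1, i)\<close> exchanges the pairs with \<open>i \<le> j\<close> and those with \<open>j < i\<close>,
  and reverses the sign of the term.
\<close>

lemma alternating_double_sum_eq_0:
  fixes c :: "nat \<Rightarrow> nat \<Rightarrow> 'a::real_vector"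
  assumes "\<And>i j. 1 \<le> i \<Longrightarrow> i \<le> j \<Longrightarrow> j \<le> m \<Longrightarrow> c i j = c (j + 1) i"
  shows "(\<Sum>i = 1..m + 1. \<Sum>j = 1..m. (- 1) ^ (i + j) *\<^sub>R c i j) = 0"
proof -
  define U where "U = {(i, j). 1 \<le> i \<and> i \<le> j \<and> j \<le> m}"
  define L where "L = {(i, j). 1 \<le> j \<and> j < i \<and> i \<le> m + 1}"
  define f where "f = (\<lambda>(i, j). (- 1) ^ (i + j) *\<^sub>R c i j)"
  have UL: "{1..m + 1} \<times> {1..m} = U \<union> L" "U \<inter> L = {}"
    by (auto simp: U_def L_def)
  have fin: "finite U" "finite L"
    by (rule finite_subset[of _ "{1..m + 1} \<times> {1..m}"]; auto simp: U_def L_def)+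
  have "sum f U = (\<Sum>p\<in>L. - f p)"
    by (rule sum.reindex_bij_witness[where i = "\<lambda>(i, j). (j, i - 1)" and j = "\<lambda>(i, j). (j + 1, i)"])
       (auto simp: U_def L_def f_def assms add.commute)
  then have "sum f U + sum f L = 0"
    by (simp add: sum_negf)
  then have "sum f ({1..m + 1} \<times> {1..m}) = 0"
    unfolding UL(1) by (simp add: sum.union_disjoint fin UL(2))
  then show ?thesis
    by (simp only: sum.cartesian_product f_def)
qed

theorem hat_coboundary_hat_coboundary:
  assumes "C0_semigroup_on V N S" "subspace V" "n \<ge> 1"
    and "\<And>u. u \<in> simplex_dom T n \<Longrightarrow> g u \<in> V"
    and "t \<in> simplex_dom T (n + 2)"
  shows "hat_coboundary T S (n + 1) (hat_coboundary T S n g) t = 0"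
proof -
  have t: "t \<in> simplex_dom T (n + 1 + 1)"
    using assms(5) by simp
  have "hat_coboundary T S (n + 1) (hat_coboundary T S n g) t =
      (\<Sum>i = 1..n + 1 + 1. (- 1) ^ i *\<^sub>R twisted_face S (n + 1) i (hat_coboundary T S n g) t)"
    by (rule hat_coboundary_eq_sum_twisted_face[OF t])
  also have "\<dots> = (\<Sum>i = 1..n + 1 + 1. (- 1) ^ i *\<^sub>R
      (\<Sum>j = 1..n + 1. (- 1) ^ j *\<^sub>R twisted_face S (n + 1) i (twisted_face S n j g) t))"
    by (intro sum.cong refl arg_cong2[where f = scaleR] twisted_face_sum[OF assms(1,2) t]
        hat_coboundary_eq_sum_twisted_face twisted_face_in[OF assms(1)] assms(3,4)) simp_all
  also have "\<dots> = (\<Sum>i = 1..n + 1 + 1. \<Sum>j = 1..n + 1.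
      (- 1) ^ (i + j) *\<^sub>R twisted_face S (n + 1) i (twisted_face S n j g) t)"
    by (simp only: scaleR_sum_right scaleR_scaleR power_add)
  also have "\<dots> = 0"
    by (rule alternating_double_sum_eq_0)
       (rule twisted_face_twisted_face[OF assms(1,5,3,4)])
  finally show ?thesis .
qed

section \<open>Cocycles are coboundaries\<close>

text \<open>
  The last face returns \<open>t\<close>, and dropping any earlier argument commutes with appending \<open>0\<close>.
  The first two arguments, which determine the time in the first face, are unchanged because
  \<open>n + 1 \<ge> 2\<close>.
\<close>

lemma hat_coboundary_append_zero:
  assumes "T > 0" "n \<ge> 1" "t \<in> simplex_dom T (n + 1)"
  shows "hat_coboundary T S (n + 1) h (append_zero (n + 1) t) =
    hat_coboundary T S n (\<lambda>u. h (append_zero n u)) t + (- 1) ^ n *\<^sub>R h t"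
proof -
  let ?u = "append_zero (n + 1) t"
  have face: "twisted_face S (n + 1) i h ?u = twisted_face S n i (\<lambda>u. h (append_zero n u)) t"
    if "i \<in> {1..n + 1}" for i
  proof -
    have "?u 1 = t 1" "?u 2 = t 2"
      using assms(2) by (simp_all add: append_zero_def)
    then show ?thesis
      using that omit_arg_append_zero[of i n t]
      by (cases "i = 1") (simp_all add: twisted_face_def del: One_nat_def)
  qed
  have last: "twisted_face S (n + 1) (n + 2) h ?u = h t"
    using omit_last_append_zero[OF assms(3)] by (simp add: twisted_face_def)
  have "hat_coboundary T S (n + 1) h ?u =
      (\<Sum>i = 1..Suc (n + 1). (- 1) ^ i *\<^sub>R twisted_face S (n + 1) i h ?u)"
    using hat_coboundary_eq_sum_twisted_face[OF append_zero_in_simplex_dom[OF assms(1,3)]] by simp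
  also have "\<dots> = (\<Sum>i = 1..n + 1. (- 1) ^ i *\<^sub>R twisted_face S (n + 1) i h ?u) +
      (- 1) ^ n *\<^sub>R h t"
    using last by (subst sum.cl_ivl_Suc) (simp_all del: sum.cl_ivl_Suc)
  also have "(\<Sum>i = 1..n + 1. (- 1) ^ i *\<^sub>R twisted_face S (n + 1) i h ?u) =
      hat_coboundary T S n (\<lambda>u. h (append_zero n u)) t"
    unfolding hat_coboundary_eq_sum_twisted_face[OF assms(3)]
    by (intro sum.cong refl arg_cong2[where f = scaleR] face)
  finally show ?thesis .
qed

lemma hat_coboundary_scaleR:
  assumes "C0_semigroup_on V N S" "subspace V" "n \<ge> 1" "t \<in> simplex_dom T (n + 1)"
    and "\<And>u. u \<in> simplex_dom T n \<Longrightarrow> f u \<in> V"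
    and "\<And>u. u \<in> simplex_dom T n \<Longrightarrow> g u = c *\<^sub>R f u"
  shows "hat_coboundary T S n g t = c *\<^sub>R hat_coboundary T S n f t"
proof -
  have "twisted_face S n i g t = c *\<^sub>R twisted_face S n i f t" for i
    using twisted_face_sum[OF assms(1,2,4,3), of "{()}" "\<lambda>_. f" g "\<lambda>_. c"] assms(5,6) by simp
  then show ?thesis
    by (simp add: hat_coboundary_eq_sum_twisted_face[OF assms(4)] scaleR_sum_right mult.commute
        del: sum.cl_ivl_Suc)
qed

lemma Metric_space_norm_dist:
  assumes "banach_space_on V N"
  shows "Metric_space V (norm_dist V N)"
proof
  have V: "subspace V" and N0: "\<And>x. x \<in> V \<Longrightarrow> N x \<ge> 0"
    and Neq: "\<And>x. x \<in> V \<Longrightarrow> N x = 0 \<longleftrightarrow> x = 0"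
    and Nscale: "\<And>c x. x \<in> V \<Longrightarrow> N (c *\<^sub>R x) = \<bar>c\<bar> * N x"
    and Nadd: "\<And>x y. x \<in> V \<Longrightarrow> y \<in> V \<Longrightarrow> N (x + y) \<le> N x + N y"
    using assms by (auto simp: banach_space_on_def)
  show "0 \<le> norm_dist V N x y" for x y
    by (simp add: norm_dist_def N0 subspace_diff[OF V])
  show "norm_dist V N x y = norm_dist V N y x" for x y
    using Nscale[of "x - y" "- 1"] by (simp add: norm_dist_def subspace_diff[OF V])
  show "norm_dist V N x y = 0 \<longleftrightarrow> x = y" if "x \<in> V" "y \<in> V" for x y
    using that by (simp add: norm_dist_def Neq subspace_diff[OF V])
  show "norm_dist V N x z \<le> norm_dist V N x y + norm_dist V N y z"
    if "x \<in> V" "y \<in> V" "z \<in> V" for x y z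
    using that Nadd[of "x - y" "y - z"] by (simp add: norm_dist_def subspace_diff[OF V])
qed

lemma topspace_norm_topology:
  assumes "banach_space_on V N"
  shows "topspace (norm_topology V N) = V"
  unfolding norm_topology_def
  by (rule Metric_space.topspace_mtopology[OF Metric_space_norm_dist[OF assms]])

lemma continuous_map_scaleR_norm_topology:
  assumes "banach_space_on V N"
  shows "continuous_map (norm_topology V N) (norm_topology V N) (\<lambda>x. c *\<^sub>R x)"
proof -
  interpret Metric_space V "norm_dist V N"
    by (rule Metric_space_norm_dist[OF assms])
  have V: "subspace V" and Nscale: "\<And>c x. x \<in> V \<Longrightarrow> N (c *\<^sub>R x) = \<bar>c\<bar> * N x"
    using assms by (auto simp: banach_space_on_def)
  have "Lipschitz_continuous_map (metric (V, norm_dist V N)) (metric (V, norm_dist V N))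
      (\<lambda>x. c *\<^sub>R x)"
    unfolding Lipschitz_continuous_map_def
  proof (intro conjI exI[of _ "\<bar>c\<bar>"] ballI)
    show "(\<lambda>x. c *\<^sub>R x) \<in> mspace (metric (V, norm_dist V N)) \<rightarrow> mspace (metric (V, norm_dist V N))"
      using V by (auto simp: subspace_scale)
    fix x y assume "x \<in> mspace (metric (V, norm_dist V N))" "y \<in> mspace (metric (V, norm_dist V N))"
    then show "mdist (metric (V, norm_dist V N)) (c *\<^sub>R x) (c *\<^sub>R y)
        \<le> \<bar>c\<bar> * mdist (metric (V, norm_dist V N)) x y"
      using Nscale[of "x - y" c] V
      by (simp add: norm_dist_def subspace_scale subspace_diff scaleR_diff_right)
  qed
  then have "continuous_map (mtopology_of (metric (V, norm_dist V N)))
      (mtopology_of (metric (V, norm_dist V N))) (\<lambda>x. c *\<^sub>R x)"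
    by (rule Lipschitz_continuous_imp_continuous_map)
  then show ?thesis
    by (simp add: norm_topology_def mtopology_of_def)
qed

abbreviation simplex_topology :: "real \<Rightarrow> nat \<Rightarrow> (nat \<Rightarrow> real) topology" where
  "simplex_topology T n \<equiv>
     subtopology (product_topology (\<lambda>_. euclideanreal) {1..n}) (simplex_dom T n)"

lemma topspace_simplex_topology: "topspace (simplex_topology T n) = simplex_dom T n"
  by (auto simp: simplex_dom_def)

lemma continuous_map_append_zero:
  assumes "T > 0"
  shows "continuous_map (simplex_topology T n) (simplex_topology T (n + 1)) (append_zero n)"
proof -
  have "continuous_map (simplex_topology T n) euclideanreal (\<lambda>t. append_zero n t k)"
    if "k \<in> {1..n + 1}" for k
  proof (cases "k \<le> n")
    case True
    then have "continuous_map (simplex_topology T n) euclideanreal (\<lambda>t. t k)"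
      using that by (intro continuous_map_from_subtopology continuous_map_product_projection) auto
    then show ?thesis
      using True that by (simp add: append_zero_def)
  next
    case False
    then show ?thesis
      using that by (simp add: append_zero_def)
  qed
  moreover have "append_zero n t \<in> extensional {1..n + 1}" for t
    by (simp add: append_zero_def)
  ultimately show ?thesis
    using append_zero_in_simplex_dom[OF assms]
    by (auto simp: continuous_map_in_subtopology continuous_map_componentwise
        topspace_simplex_topology simp del: topspace_subtopology One_nat_def)
qed

lemma cochains_in:
  assumes "banach_space_on V N" "g \<in> cochains T n V N" "t \<in> simplex_dom T n"
  shows "g t \<in> V"
proof -
  have "continuous_map (simplex_topology T n) (norm_topology V N) g"
    using assms(2) by (simp add: cochains_def)
  from continuous_map_funspace[OF this] assms(3) show ?thesis
    by (auto simp: topspace_simplex_topology topspace_norm_topology[OF assms(1)]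
        simp del: topspace_subtopology One_nat_def)
qed

text \<open>The scalar \<open>c\<close> absorbs the sign by which the cone misses being a homotopy.\<close>

lemma cone_in_cochains:
  assumes "banach_space_on V N" "T > 0" "h \<in> cochains T (n + 1) V N"
  shows "(\<lambda>t\<in>simplex_dom T n. c *\<^sub>R h (append_zero n t)) \<in> cochains T n V N"
proof -
  have "continuous_map (simplex_topology T (n + 1)) (norm_topology V N) h"
    using assms(3) by (simp add: cochains_def)
  from continuous_map_compose[OF continuous_map_compose[OF continuous_map_append_zero[OF assms(2)] this]
      continuous_map_scaleR_norm_topology[OF assms(1), of c]]
  have "continuous_map (simplex_topology T n) (norm_topology V N)
      (\<lambda>t. c *\<^sub>R h (append_zero n t))"
    by (simp add: o_def)
  then have "continuous_map (simplex_topology T n) (norm_topology V N)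
      (\<lambda>t\<in>simplex_dom T n. c *\<^sub>R h (append_zero n t))"
    by (rule continuous_map_eq) (simp add: topspace_simplex_topology del: topspace_subtopology One_nat_def)
  then show ?thesis
    by (simp add: cochains_def)
qed

theorem lemma2p3:
  fixes T \<alpha> :: real and n :: nat
    and B :: "real \<Rightarrow> 'a::real_vector set"
    and N :: "real \<Rightarrow> 'a \<Rightarrow> real"
    and S :: "real \<Rightarrow> 'a \<Rightarrow> 'a"
  assumes "T > 0"
    and "banach_scale B N"
    and "analytic_semigroup_on_scale T B N S"
    and "n \<ge> 1"
  shows "hat_cocycles T S (n + 1) (B \<alpha>) (N \<alpha>) = hat_coboundaries T S (n + 1) (B \<alpha>) (N \<alpha>)"
proof -
  have banach: "banach_space_on (B \<alpha>) (N \<alpha>)"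
    using assms(2) by (simp add: banach_scale_def)
  then have V: "subspace (B \<alpha>)"
    by (simp add: banach_space_on_def)
  have S: "C0_semigroup_on (B \<alpha>) (N \<alpha>) S"
    using assms(3) by (simp add: analytic_semigroup_on_scale_def analytic_semigroup_on_def)
  show ?thesis
  proof (intro equalityI subsetI)
    fix h assume "h \<in> hat_cocycles T S (n + 1) (B \<alpha>) (N \<alpha>)"
    then have h: "h \<in> cochains T (n + 1) (B \<alpha>) (N \<alpha>)"
      and cocycle: "hat_coboundary T S (n + 1) h = (\<lambda>t\<in>simplex_dom T (n + 2). 0)"
      by (simp_all add: hat_cocycles_def)
    define g where "g = (\<lambda>t\<in>simplex_dom T n. (- 1) ^ (n + 1) *\<^sub>R h (append_zero n t))"
    have "hat_coboundary T S n g = h"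
    proof (rule extensionalityI[of _ "simplex_dom T (n + 1)"])
      show "hat_coboundary T S n g \<in> extensional (simplex_dom T (n + 1))"
        by (simp add: hat_coboundary_def)
      show "h \<in> extensional (simplex_dom T (n + 1))"
        using h by (simp add: cochains_def)
      fix t assume t: "t \<in> simplex_dom T (n + 1)"
      have "hat_coboundary T S (n + 1) h (append_zero (n + 1) t) = 0"
        unfolding cocycle using append_zero_in_simplex_dom[OF assms(1) t] by simp
      then have cone: "hat_coboundary T S n (\<lambda>u. h (append_zero n u)) t = - ((- 1) ^ n *\<^sub>R h t)"
        using hat_coboundary_append_zero[OF assms(1,4) t, of S h] by (simp add: eq_neg_iff_add_eq_0)
      have "hat_coboundary T S n g t =
          (- 1) ^ (n + 1) *\<^sub>R hat_coboundary T S n (\<lambda>u. h (append_zero n u)) t"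
        using cochains_in[OF banach h] append_zero_in_simplex_dom[OF assms(1)]
        by (intro hat_coboundary_scaleR[OF S V assms(4) t]) (simp_all add: g_def)
      also have "\<dots> = h t"
        unfolding cone by (simp flip: power_add)
      finally show "hat_coboundary T S n g t = h t" .
    qed
    moreover have "g \<in> cochains T n (B \<alpha>) (N \<alpha>)"
      unfolding g_def by (rule cone_in_cochains[OF banach assms(1) h])
    ultimately show "h \<in> hat_coboundaries T S (n + 1) (B \<alpha>) (N \<alpha>)"
      using h by (auto simp: hat_coboundaries_def)
  next
    fix h assume "h \<in> hat_coboundaries T S (n + 1) (B \<alpha>) (N \<alpha>)"
    then obtain g where g: "g \<in> cochains T n (B \<alpha>) (N \<alpha>)" "h = hat_coboundary T S n g"
      and h: "h \<in> cochains T (n + 1) (B \<alpha>) (N \<alpha>)"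
      by (auto simp: hat_coboundaries_def)
    have "hat_coboundary T S (n + 1) h = (\<lambda>t\<in>simplex_dom T (n + 2). 0)"
    proof (rule extensionalityI[of _ "simplex_dom T (n + 2)"])
      show "hat_coboundary T S (n + 1) h \<in> extensional (simplex_dom T (n + 2))"
        by (simp add: hat_coboundary_def)
      fix t assume "t \<in> simplex_dom T (n + 2)"
      then show "hat_coboundary T S (n + 1) h t = (\<lambda>t\<in>simplex_dom T (n + 2). 0) t"
        unfolding g(2)
        using hat_coboundary_hat_coboundary[OF S V assms(4) cochains_in[OF banach g(1)]] by simp
    qed simp
    then show "h \<in> hat_cocycles T S (n + 1) (B \<alpha>) (N \<alpha>)"
      using h by (simp add: hat_cocycles_def)
  qed
qed

end
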